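(* Let $X$ and $Y$ be real Banach spaces, let $x\in S_X$, $y\in S_Y$, and let $N$ be an $A$-octahedral absolute normalised norm on $\mathbb{R}^2$, where $A=\{(c,1),(1,d)\}$ with $c=\max\{e : N(e,1)=1\}$ and $d=\max\{f : N(1,f)=1\}$. Let $(a,b)\in\mathbb{R}^2$ be such that $a,b\ge 0$, $N(a,b)=1$, $N\big((a,b)+(c,1)\big)=2$ and $N\big((a,b)+(1,d)\big)=2$. If $x$ is a Daugavet-point in $X$ and $y$ is a Daugavet-point in $Y$, then $(ax,by)$ is a Daugavet-point in $X\oplus_N Y$.
   Context: All Banach spaces are real. $B_X$ and $S_X$ denote the closed unit ball and unit sphere of $X$. For $x\in S_X$ and $\varepsilon>0$ put $\Delta_\varepsilon(x)=\{y\in B_X : \|x-y\|\ge 2-\varepsilon\}$. A point $x\in S_X$ is a Daugavet-point of $X$ if $B_X\subset\overline{\mathrm{conv}}\,\Delta_\varepsilon(x)$ for every $\varepsilon>0$. A norm $N$ on $\mathbb{R}^2$ is absolute if $N(a,b)=N(|a|,|b|)$ for all $(a,b)\in\mathbb{R}^2$, and normalised if $N(1,0)=N(0,1)=1$. For such $N$, $X\oplus_N Y$ is the direct sum $X\oplus Y$ with norm $\|(x,y)\|_N=N(\|x\|,\|y\|)$. For a Banach space $Z$ and $A\subset S_Z$, the norm of $Z$ is called $A$-octahedral ($A$-OH) if for every $z_1,\dots,z_n\in A$ and every $\varepsilon>0$ there exists $w\in S_Z$ such that $\|z_i+w\|\ge 2-\varepsilon$ for every $i\in\{1,\dots,n\}$.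 Here this is applied to $Z=(\mathbb{R}^2,N)$. If $N$ is $A$-OH for the set $A=\{(c,1),(1,d)\}$, where $c=\max\{e : N(e,1)=1\}$ and $d=\max\{f : N(1,f)=1\}$, then a pair $(a,b)\in\mathbb{R}^2$ with $a,b\ge 0$, $N(a,b)=1$, $N\big((a,b)+(c,1)\big)=2$ and $N\big((a,b)+(1,d)\big)=2$ exists. *)

theory Defs
  imports "HOL-Analysis.Analysis"
begin

text \<open>The norm \<open>N\<close> of \<open>X \<oplus>\<^sub>N Y\<close> is a variable, so \<open>X \<oplus>\<^sub>N Y\<close> cannot be an instance of
  the class \<^class>\<open>real_normed_vector\<close>. The notions below therefore take the norm as an
  explicit argument; for a Banach space given as a type, that argument is \<^const>\<open>norm\<close>.\<close>

definition is_norm :: "('a::real_vector \<Rightarrow> real) \<Rightarrow> bool" where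
  "is_norm \<nu> \<longleftrightarrow>
     (\<forall>u. 0 \<le> \<nu> u) \<and> (\<forall>u. \<nu> u = 0 \<longleftrightarrow> u = 0) \<and>
     (\<forall>r u. \<nu> (r *\<^sub>R u) = \<bar>r\<bar> * \<nu> u) \<and>
     (\<forall>u v. \<nu> (u + v) \<le> \<nu> u + \<nu> v)"

definition norm_topology :: "('a::real_vector \<Rightarrow> real) \<Rightarrow> 'a topology" where
  "norm_topology \<nu> = Metric_space.mtopology UNIV (\<lambda>u v. \<nu> (u - v))"

definition Delta :: "('a::real_vector \<Rightarrow> real) \<Rightarrow> real \<Rightarrow> 'a \<Rightarrow> 'a set" where
  "Delta \<nu> \<epsilon> x = {y. \<nu> y \<le> 1 \<and> \<nu> (x - y) \<ge> 2 - \<epsilon>}"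

definition Daugavet_point :: "('a::real_vector \<Rightarrow> real) \<Rightarrow> 'a \<Rightarrow> bool" where
  "Daugavet_point \<nu> x \<longleftrightarrow>
     \<nu> x = 1 \<and>
     (\<forall>\<epsilon>>0. {u. \<nu> u \<le> 1} \<subseteq> norm_topology \<nu> closure_of (convex hull (Delta \<nu> \<epsilon> x)))"

definition absolute_norm :: "(real \<times> real \<Rightarrow> real) \<Rightarrow> bool" where
  "absolute_norm N \<longleftrightarrow> is_norm N \<and> (\<forall>a b. N (a, b) = N (\<bar>a\<bar>, \<bar>b\<bar>))"

definition normalised :: "(real \<times> real \<Rightarrow> real) \<Rightarrow> bool" where
  "normalised N \<longleftrightarrow> N (1, 0) = 1 \<and> N (0, 1) = 1"

definition sum_norm ::
  "(real \<times> real \<Rightarrow> real) \<Rightarrow> 'a::real_normed_vector \<times> 'b::real_normed_vector \<Rightarrow> real" where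
  "sum_norm N z = N (norm (fst z), norm (snd z))"

definition octahedral_on :: "'a::real_vector set \<Rightarrow> ('a \<Rightarrow> real) \<Rightarrow> bool" where
  "octahedral_on A \<nu> \<longleftrightarrow>
     A \<subseteq> {z. \<nu> z = 1} \<and>
     (\<forall>(n::nat) z. (\<forall>i\<in>{1..n}. z i \<in> A) \<longrightarrow>
        (\<forall>\<epsilon>>0. \<exists>w. \<nu> w = 1 \<and> (\<forall>i\<in>{1..n}. \<nu> (z i + w) \<ge> 2 - \<epsilon>)))"

lemma norm_topology_norm:
  "norm_topology (norm :: 'a::real_normed_vector \<Rightarrow> real) = euclidean"
  by (simp add: norm_topology_def flip: dist_norm)

lemma Daugavet_point_norm_iff:
  fixes x :: "'a::real_normed_vector"
  shows "Daugavet_point norm x \<longleftrightarrow>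
    x \<in> sphere 0 1 \<and>
    (\<forall>\<epsilon>>0. cball 0 1 \<subseteq> closure (convex hull {y \<in> cball 0 1. norm (x - y) \<ge> 2 - \<epsilon>}))"
  by (simp add: Daugavet_point_def norm_topology_norm Delta_def cball_def sphere_def)

lemma Metric_space_is_norm:
  assumes "is_norm \<nu>"
  shows "Metric_space UNIV (\<lambda>u v. \<nu> (u - v))"
proof
  fix u v w :: 'a
  show "0 \<le> \<nu> (u - v)" using assms by (simp add: is_norm_def)
  have "\<nu> ((-1) *\<^sub>R (u - v)) = \<bar>-1\<bar> * \<nu> (u - v)"
    using assms unfolding is_norm_def by blast
  then show "\<nu> (u - v) = \<nu> (v - u)" by simp
  show "\<nu> (u - v) = 0 \<longleftrightarrow> u = v" using assms by (simp add: is_norm_def)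
  have "\<nu> ((u - v) + (v - w)) \<le> \<nu> (u - v) + \<nu> (v - w)"
    using assms unfolding is_norm_def by blast
  then show "\<nu> (u - w) \<le> \<nu> (u - v) + \<nu> (v - w)" by simp
qed

lemma absolute_norm_mono:
  assumes N: "absolute_norm N" and "0 \<le> a" "a \<le> a'" "0 \<le> b" "b \<le> b'"
  shows "N (a, b) \<le> N (a', b')"
proof -
  have abs: "N (p, q) = N (\<bar>p\<bar>, \<bar>q\<bar>)" for p q
    using N by (simp add: absolute_norm_def)
  have tri: "N (u + v) \<le> N u + N v" and hom: "N (r *\<^sub>R u) = \<bar>r\<bar> * N u" for u v r
    using N unfolding absolute_norm_def is_norm_def by blast+
  have comb: "N (s *\<^sub>R u + (1 - s) *\<^sub>R v) \<le> K"
    if "0 \<le> s" "s \<le> 1" "N u = K" "N v = K" for s u v K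
  proof -
    have "N (s *\<^sub>R u + (1 - s) *\<^sub>R v) \<le> s * K + (1 - s) * K"
      using tri[of "s *\<^sub>R u" "(1 - s) *\<^sub>R v"] that by (simp only: hom abs_of_nonneg diff_ge_0_iff_ge)
    then show ?thesis by (simp add: algebra_simps)
  qed
  have fst: "N (a, b) \<le> N (a', b)"
  proof (cases "a' = 0")
    case False
    define s where "s = (1 + a / a') / 2"
    have s: "0 \<le> s" "s \<le> 1" using assms False by (auto simp: s_def field_simps)
    have "s * a' + (1 - s) * (- a') = a"
      using False by (simp add: s_def field_simps)
    then have "(a, b) = s *\<^sub>R (a', b) + (1 - s) *\<^sub>R (- a', b)"
      by (simp add: algebra_simps)
    then show ?thesis
      using comb[OF s, of "(a', b)" "N (a', b)" "(- a', b)"] abs[of "- a'" b] abs[of a' b] by simp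
  qed (use assms in auto)
  have "N (a', b) \<le> N (a', b')"
  proof (cases "b' = 0")
    case False
    define s where "s = (1 + b / b') / 2"
    have s: "0 \<le> s" "s \<le> 1" using assms False by (auto simp: s_def field_simps)
    have "s * b' + (1 - s) * (- b') = b"
      using False by (simp add: s_def field_simps)
    then have "(a', b) = s *\<^sub>R (a', b') + (1 - s) *\<^sub>R (a', - b')"
      by (simp add: algebra_simps)
    then show ?thesis
      using comb[OF s, of "(a', b')" "N (a', b')" "(a', - b')"] abs[of a' "- b'"] abs[of a' b'] by simp
  qed (use assms in auto)
  with fst show ?thesis by simp
qed

lemma is_norm_sum_norm:
  assumes N: "absolute_norm N"
  shows "is_norm (sum_norm N :: 'a::real_normed_vector \<times> 'b::real_normed_vector \<Rightarrow> real)"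
proof -
  have nN: "is_norm N" using N by (simp add: absolute_norm_def)
  have "sum_norm N (r *\<^sub>R u) = \<bar>r\<bar> * sum_norm N u" for r and u :: "'a \<times> 'b"
  proof -
    have "N (\<bar>r\<bar> *\<^sub>R (norm (fst u), norm (snd u))) = \<bar>\<bar>r\<bar>\<bar> * N (norm (fst u), norm (snd u))"
      using nN unfolding is_norm_def by blast
    then show ?thesis by (simp add: sum_norm_def)
  qed
  moreover have "sum_norm N (u + v) \<le> sum_norm N u + sum_norm N v" for u v :: "'a \<times> 'b"
  proof -
    have "sum_norm N (u + v) \<le> N (norm (fst u) + norm (fst v), norm (snd u) + norm (snd v))"
      unfolding sum_norm_def by (rule absolute_norm_mono[OF N]) (auto intro: norm_triangle_ineq)
    also have "\<dots> = N ((norm (fst u), norm (snd u)) + (norm (fst v), norm (snd v)))" by simp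
    also have "\<dots> \<le> sum_norm N u + sum_norm N v"
      using nN unfolding is_norm_def sum_norm_def by blast
    finally show ?thesis .
  qed
  moreover have "0 \<le> sum_norm N u" "sum_norm N u = 0 \<longleftrightarrow> u = 0" for u :: "'a \<times> 'b"
    using nN by (simp_all add: is_norm_def sum_norm_def zero_prod_def prod_eq_iff)
  ultimately show ?thesis unfolding is_norm_def by blast
qed

lemma absolute_norm_swap:
  assumes "absolute_norm N" "normalised N"
  shows "absolute_norm (\<lambda>(a, b). N (b, a))" "normalised (\<lambda>(a, b). N (b, a))"
proof -
  have nN: "is_norm N" using assms by (simp add: absolute_norm_def)
  have "N (snd u + snd v, fst u + fst v) \<le> N (snd u, fst u) + N (snd v, fst v)" for u v
  proof -
    have "N ((snd u, fst u) + (snd v, fst v)) \<le> N (snd u, fst u) + N (snd v, fst v)"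
      using nN unfolding is_norm_def by blast
    then show ?thesis by simp
  qed
  moreover have "N (r * snd u, r * fst u) = \<bar>r\<bar> * N (snd u, fst u)" for r u
  proof -
    have "N (r *\<^sub>R (snd u, fst u)) = \<bar>r\<bar> * N (snd u, fst u)"
      using nN unfolding is_norm_def by blast
    then show ?thesis by simp
  qed
  ultimately have "is_norm (\<lambda>(a, b). N (b, a))"
    using nN unfolding is_norm_def by (auto simp: case_prod_unfold zero_prod_def prod_eq_iff)
  then show "absolute_norm (\<lambda>(a, b). N (b, a))" "normalised (\<lambda>(a, b). N (b, a))"
    using assms by (auto simp: absolute_norm_def normalised_def)
qed

text \<open>The maxima \<open>max {e. N (e, 1) = 1}\<close> and \<open>max {f. N (1, f) = 1}\<close> range over infinite sets in
  general, where \<^const>\<open>Max\<close> is unspecified; they are written with \<^const>\<open>Greatest\<close>, and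
  the next two lemmas show that they are attained.\<close>

lemma Greatest_fst:
  assumes N: "absolute_norm N" and nrm: "normalised N"
  shows "N (GREATEST e. N (e, 1) = 1, 1) = 1"
    and "N (e, 1) = 1 \<Longrightarrow> e \<le> (GREATEST e. N (e, 1) = 1)"
proof -
  have nN: "is_norm N" using N by (simp add: absolute_norm_def)
  have tri: "N (u + v) \<le> N u + N v" and hom: "N (r *\<^sub>R u) = \<bar>r\<bar> * N u" for u v r
    using nN unfolding is_norm_def by blast+
  have e0: "N (e, 0) = \<bar>e\<bar>" for e
    using hom[of e "(1, 0)"] nrm by (simp add: normalised_def)
  define S where "S = {e. N (e, 1) = 1}"
  have lip: "\<bar>N (p, 1) - N (q, 1)\<bar> \<le> \<bar>p - q\<bar>" for p q
    using tri[of "(p - q, 0)" "(q, 1)"] tri[of "(q - p, 0)" "(p, 1)"] by (simp add: e0)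
  have "continuous_on UNIV (\<lambda>e. N (e, 1))"
    unfolding continuous_on_iff dist_real_def using lip by (meson order_le_less_trans)
  then have "closed S"
    unfolding S_def by (intro closed_Collect_eq) auto
  moreover have "\<bar>e\<bar> \<le> 2" if "e \<in> S" for e
    using tri[of "(e, 1)" "(0, -1)"] hom[of "-1" "(0, 1)"] nrm that
    by (simp add: e0 S_def normalised_def)
  then have "bounded S" by (auto simp: bounded_iff)
  moreover have "0 \<in> S" using nrm by (simp add: S_def normalised_def)
  ultimately obtain m where m: "m \<in> S" "\<forall>e\<in>S. e \<le> m"
    using compact_attains_sup[of S] compact_eq_bounded_closed by blast
  then have "(GREATEST e. N (e, 1) = 1) = m"
    by (intro Greatest_equality) (auto simp: S_def)
  then show "N (GREATEST e. N (e, 1) = 1, 1) = 1"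
    and "N (e, 1) = 1 \<Longrightarrow> e \<le> (GREATEST e. N (e, 1) = 1)"
    using m by (auto simp: S_def)
qed

lemma Greatest_snd:
  assumes "absolute_norm N" and "normalised N"
  shows "N (1, GREATEST f. N (1, f) = 1) = 1"
    and "N (1, f) = 1 \<Longrightarrow> f \<le> (GREATEST f. N (1, f) = 1)"
  using Greatest_fst[OF absolute_norm_swap[OF assms]] by simp_all

end

theory Submission
  imports Defs
begin

text \<open>If \<open>x\<close> and \<open>y\<close> are Daugavet-points and \<open>N (s, t) = 1\<close>, \<open>N (a + s, b + t) = 2\<close>, then all
  points \<open>(s p, t q)\<close> with \<open>p\<close> almost at distance \<open>2\<close> from \<open>x\<close> and \<open>q\<close> almost at distance \<open>2\<close> from
  \<open>y\<close> are almost at distance \<open>2\<close> from \<open>(a x, b y)\<close>, and their closed convex hull contains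
  \<open>s B\<^sub>X \<times> t B\<^sub>Y\<close>. It remains to see that these rectangles cover the unit ball, that is, that every
  \<open>(s, t) \<ge> 0\<close> in the unit ball of \<open>N\<close> is dominated by a point at which the norm is additive with
  \<open>(a, b)\<close>. Such points are found on the segments joining \<open>(a, b)\<close> to \<open>(c, 1)\<close> and to \<open>(1, d)\<close>: a
  point of the unit ball above one of these segments would make \<open>N\<close> constant on a vertical or
  horizontal interval, which happens only on the flat parts that are dominated by \<open>(1, d)\<close> and
  \<open>(c, 1)\<close>.\<close>

section \<open>Absolute normalised norms on the plane\<close>

locale absolute_normalised_norm =
  fixes N :: "real \<times> real \<Rightarrow> real"
  assumes absolute: "absolute_norm N" and normalised: "normalised N"
begin

lemma triangle: "N (u + v) \<le> N u + N v"
  using absolute unfolding absolute_norm_def is_norm_def by blast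

lemma scale: "N (r *\<^sub>R u) = \<bar>r\<bar> * N u"
  using absolute unfolding absolute_norm_def is_norm_def by blast

lemma axis_fst: "N (r, 0) = \<bar>r\<bar>"
  using scale[of r "(1, 0)"] normalised by (simp add: normalised_def)

lemma axis_snd: "N (0, r) = \<bar>r\<bar>"
  using scale[of r "(0, 1)"] normalised by (simp add: normalised_def)

lemmas mono = absolute_norm_mono[OF absolute]

lemma fst_le: "0 \<le> s \<Longrightarrow> 0 \<le> t \<Longrightarrow> s \<le> N (s, t)"
  using mono[of s s 0 t] by (simp add: axis_fst)

lemma snd_le: "0 \<le> s \<Longrightarrow> 0 \<le> t \<Longrightarrow> t \<le> N (s, t)"
  using mono[of 0 s t t] by (simp add: axis_snd)

lemma le_sum: "N (s, t) \<le> \<bar>s\<bar> + \<bar>t\<bar>"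
  using triangle[of "(s, 0)" "(0, t)"] by (simp add: axis_fst axis_snd)

text \<open>Additivity at \<open>u\<close>, \<open>v\<close> passes to the cone they span: going
  from \<open>\<alpha> *\<^sub>R (u + v)\<close>, of norm \<open>2 * \<alpha>\<close>, down to the
  given combination removes a multiple of \<open>v\<close> of norm at most
  \<open>\<alpha> - \<beta>\<close>.\<close>

lemma additive_ray:
  assumes "N u \<le> 1" "N v \<le> 1" "N (u + v) = 2" "0 \<le> \<beta>" "\<beta> \<le> \<alpha>"
  shows "\<alpha> + \<beta> \<le> N (\<alpha> *\<^sub>R u + \<beta> *\<^sub>R v)"
proof -
  have "\<alpha> *\<^sub>R (u + v) = (\<alpha> *\<^sub>R u + \<beta> *\<^sub>R v) + (\<alpha> - \<beta>) *\<^sub>R v"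
    by (simp add: algebra_simps)
  then have "2 * \<alpha> \<le> N (\<alpha> *\<^sub>R u + \<beta> *\<^sub>R v) + (\<alpha> - \<beta>) * N v"
    using triangle[of "\<alpha> *\<^sub>R u + \<beta> *\<^sub>R v" "(\<alpha> - \<beta>) *\<^sub>R v"] scale[of \<alpha> "u + v"]
      scale[of "\<alpha> - \<beta>" v] assms by simp
  moreover have "(\<alpha> - \<beta>) * N v \<le> (\<alpha> - \<beta>) * 1"
    using assms by (intro mult_left_mono) auto
  ultimately show ?thesis by simp
qed

lemma segment_norm:
  assumes "N u = 1" "N v = 1" "N (u + v) = 2" "0 \<le> l" "l \<le> 1"
  shows "N (l *\<^sub>R u + (1 - l) *\<^sub>R v) = 1"
    and "N (u + (l *\<^sub>R u + (1 - l) *\<^sub>R v)) = 2"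
proof -
  let ?w = "l *\<^sub>R u + (1 - l) *\<^sub>R v"
  have le: "N ?w \<le> 1"
    using triangle[of "l *\<^sub>R u" "(1 - l) *\<^sub>R v"] scale[of l u] scale[of "1 - l" v] assms by simp
  have "u + ?w = (1 + l) *\<^sub>R u + (1 - l) *\<^sub>R v"
    by (simp add: algebra_simps)
  then have "2 \<le> N (u + ?w)"
    using additive_ray[of u v "1 - l" "1 + l"] assms by (simp only:) simp
  then show "N ?w = 1" "N (u + ?w) = 2"
    using triangle[of u ?w] le assms by linarith+
qed

text \<open>By convexity: \<open>(s, \<tau>)\<close> lies between \<open>(s, 0)\<close>, of norm
  \<open>s\<close>, and \<open>(s, t)\<close>, and \<open>(s, 0)\<close> has positive
  weight.\<close>

lemma vertical_flat:
  assumes "0 \<le> s" "0 \<le> \<tau>" "\<tau> < t" "1 \<le> N (s, \<tau>)" "N (s, t) \<le> 1"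
  shows "1 \<le> s"
proof -
  define l where "l = \<tau> / t"
  have l: "0 \<le> l" "l < 1" using assms by (auto simp: l_def)
  have "(s, \<tau>) = (1 - l) *\<^sub>R (s, 0) + l *\<^sub>R (s, t)"
    using assms by (simp add: l_def algebra_simps)
  then have "N (s, \<tau>) \<le> (1 - l) * s + l * N (s, t)"
    using triangle[of "(1 - l) *\<^sub>R (s, 0)" "l *\<^sub>R (s, t)"] scale[of "1 - l" "(s, 0)"]
      scale[of l "(s, t)"] axis_fst[of s] l assms by simp
  moreover have "l * N (s, t) \<le> l * 1" using l assms by (intro mult_left_mono) auto
  ultimately have "(1 - l) * 1 \<le> (1 - l) * s" using assms by simp
  then show ?thesis using l by simp
qed

lemma strictly_dominated:
  assumes "0 \<le> a" "a < s" "0 \<le> b" "b < t" "N (s, t) \<le> 1"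
  shows "N (a, b) < 1"
proof -
  \<comment> \<open>The least factor that makes \<open>m *\<^sub>R (s, t)\<close> dominate
    \<open>(a, b)\<close>.\<close>
  define m where "m = max (a / s) (b / t)"
  have m: "0 \<le> m" "m < 1" using assms by (auto simp: m_def le_max_iff_disj)
  have "a / s \<le> m" "b / t \<le> m" by (auto simp: m_def)
  then have "a \<le> m * s" "b \<le> m * t" using assms by (simp_all add: field_simps)
  then have "N (a, b) \<le> N (m *\<^sub>R (s, t))" using mono[of a "m * s" b "m * t"] assms by simp
  also have "\<dots> \<le> m * 1"
    unfolding scale using m assms by (simp add: mult_left_le)
  finally show ?thesis using m by simp
qed

lemma dominated_by_segment:
  assumes ab: "0 \<le> a" "0 \<le> b" "N (a, b) = 1"
    and d: "0 \<le> d" "N (1, d) = 1" "N ((a, b) + (1, d)) = 2"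
    and st: "0 \<le> s" "0 \<le> t" "N (s, t) \<le> 1" "a < s" "t \<le> b" "s < 1"
  shows "\<exists>s' t'. s \<le> s' \<and> t \<le> t' \<and> N (s', t') = 1 \<and> N (a + s', b + t') = 2"
proof -
  \<comment> \<open>The weight at which the segment from \<open>(1, d)\<close> to
    \<open>(a, b)\<close> has first coordinate \<open>s\<close>.\<close>
  define l where "l = (1 - s) / (1 - a)"
  have l: "0 \<le> l" "l \<le> 1" using st by (auto simp: l_def field_simps)
  have "l * (1 - a) = 1 - s" using st by (simp add: l_def)
  then have s: "l * a + (1 - l) = s" by (simp add: algebra_simps)
  define \<tau> where "\<tau> = l * b + (1 - l) * d"
  have w: "l *\<^sub>R (a, b) + (1 - l) *\<^sub>R (1, d) = (s, \<tau>)"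
    by (simp add: \<tau>_def s)
  have "N (s, \<tau>) = 1" "N (a + s, b + \<tau>) = 2"
    using segment_norm[OF ab(3) d(2,3) l] by (simp_all only: w add_Pair)
  moreover have "t \<le> \<tau>"
  proof (rule ccontr)
    assume "\<not> t \<le> \<tau>"
    moreover have "0 \<le> \<tau>" using l ab d by (simp add: \<tau>_def)
    ultimately have "1 \<le> s"
      using vertical_flat[of s \<tau> t] st \<open>N (s, \<tau>) = 1\<close> by simp
    with st show False by simp
  qed
  ultimately show ?thesis by blast
qed

lemma dominated_by_additive:
  assumes ab: "0 \<le> a" "0 \<le> b" "N (a, b) = 1"
    and c: "c = (GREATEST e. N (e, 1) = 1)" "N ((a, b) + (c, 1)) = 2"
    and d: "d = (GREATEST f. N (1, f) = 1)" "N ((a, b) + (1, d)) = 2"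
    and st: "0 \<le> s" "0 \<le> t" "N (s, t) \<le> 1"
  shows "\<exists>s' t'. s \<le> s' \<and> t \<le> t' \<and> N (s', t') = 1 \<and> N (a + s', b + t') = 2"
proof -
  \<comment> \<open>Exchanging the coordinates reduces the last case below to the one before it,
    with \<open>(c, 1)\<close> in the role of \<open>(1, d)\<close>.\<close>
  interpret swap: absolute_normalised_norm "\<lambda>(a, b). N (b, a)"
    using absolute_norm_swap[OF absolute normalised] by unfold_locales
  have s1: "s \<le> 1" and t1: "t \<le> 1"
    using fst_le[of s t] snd_le[of s t] st by simp_all
  have Nc: "N (c, 1) = 1" and c_max: "\<And>e. N (e, 1) = 1 \<Longrightarrow> e \<le> c"
    using Greatest_fst[OF absolute normalised] c by auto
  have Nd: "N (1, d) = 1" and d_max: "\<And>f. N (1, f) = 1 \<Longrightarrow> f \<le> d"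
    using Greatest_snd[OF absolute normalised] d by auto
  have c0: "0 \<le> c" and d0: "0 \<le> d"
    using c_max[of 0] d_max[of 0] axis_fst[of 1] axis_snd[of 1] by simp_all
  \<comment> \<open>The dominating points are \<open>(c, 1)\<close>, \<open>(1, d)\<close> and
    \<open>(a, b)\<close> in the first three cases; the fourth contradicts
    \<open>N (a, b) = 1\<close>; the last two need a segment.\<close>
  consider "s \<le> c" | "t \<le> d" | "s \<le> a" "t \<le> b" | "a < s" "b < t"
    | "a < s" "t \<le> b" "d < t" | "s \<le> a" "b < t" "c < s"
    by linarith
  then show ?thesis
  proof cases
    case 1
    then show ?thesis using t1 Nc c by auto
  next
    case 2
    then show ?thesis using s1 Nd d by auto
  next
    case 3
    moreover have "N (a + a, b + b) = 2" using ab scale[of 2 "(a, b)"] by simp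
    ultimately show ?thesis using ab by blast
  next
    case 4
    then show ?thesis using strictly_dominated[of a s b t] ab st by simp
  next
    case 5
    have "s \<noteq> 1"
    proof
      assume "s = 1"
      then have "N (1, t) = 1" using st fst_le[of s t] by simp
      then show False using d_max[of t] 5 by simp
    qed
    then show ?thesis
      using dominated_by_segment[OF ab d0 Nd d(2) st] 5 s1 by simp
  next
    case 6
    have "t \<noteq> 1"
    proof
      assume "t = 1"
      then have "N (s, 1) = 1" using st snd_le[of s t] by simp
      then show False using c_max[of s] 6 by simp
    qed
    then show ?thesis
      using swap.dominated_by_segment[of b a c t s] ab c0 Nc c(2) st 6 t1 by auto
  qed
qed

end

section \<open>Estimates in the two summands\<close>

lemma norm_diff_scaled_ge:
  fixes x p :: "'a::real_normed_vector"
  assumes "norm x \<le> 1" "norm p \<le> 1" "2 - \<delta> \<le> norm (x - p)" "0 \<le> \<delta>"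
    and "0 \<le> a" "a \<le> 1" "0 \<le> s" "s \<le> 1"
  shows "a + s - \<delta> \<le> norm (a *\<^sub>R x - s *\<^sub>R p)"
proof -
  \<comment> \<open>Scaling both points by the larger factor keeps their near-additivity; one of the
    two correction terms vanishes, and the other costs at most the gap between \<open>a\<close> and
    \<open>s\<close>.\<close>
  have "max a s *\<^sub>R (x - p)
      = (a *\<^sub>R x - s *\<^sub>R p) + ((max a s - a) *\<^sub>R x + (s - max a s) *\<^sub>R p)"
    by (simp add: algebra_simps)
  then have "max a s * norm (x - p) \<le> norm (a *\<^sub>R x - s *\<^sub>R p)
      + ((max a s - a) * norm x + (max a s - s) * norm p)"
    using norm_triangle_ineq[of "a *\<^sub>R x - s *\<^sub>R p" "(max a s - a) *\<^sub>R x + (s - max a s) *\<^sub>R p"]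
      norm_triangle_ineq[of "(max a s - a) *\<^sub>R x" "(s - max a s) *\<^sub>R p"]
      norm_scaleR[of "max a s" "x - p"] assms by (auto simp: max_def split: if_splits)
  moreover have "max a s * (2 - \<delta>) \<le> max a s * norm (x - p)"
    using assms by (intro mult_left_mono) auto
  moreover have "(max a s - a) * norm x \<le> (max a s - a) * 1" "(max a s - s) * norm p \<le> (max a s - s) * 1"
    using assms by (intro mult_left_mono; simp)+
  moreover have "max a s * \<delta> \<le> 1 * \<delta>"
    using assms by (intro mult_right_mono) auto
  ultimately show ?thesis by (simp add: algebra_simps)
qed

lemma closure_of_norm_topology_iff:
  assumes "is_norm \<nu>"
  shows "u \<in> norm_topology \<nu> closure_of S \<longleftrightarrow> (\<forall>r>0. \<exists>v\<in>S. \<nu> (u - v) < r)"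
proof -
  interpret Metric_space UNIV "\<lambda>u v. \<nu> (u - v)"
    using Metric_space_is_norm[OF assms] .
  show ?thesis
    by (auto simp: norm_topology_def metric_closure_of)
qed

lemma Daugavet_point_approx:
  fixes x :: "'a::real_normed_vector"
  assumes "Daugavet_point norm x" "0 < \<delta>" "norm u \<le> s"
  obtains p where "p \<in> convex hull Delta norm \<delta> x" "norm (u - s *\<^sub>R p) \<le> s * \<delta>"
proof -
  have s: "0 \<le> s" using assms(3) norm_ge_zero[of u] by linarith
  \<comment> \<open>For \<open>s = 0\<close> the quotient is \<open>0\<close> by convention, and
    \<open>u = 0\<close>, so no separate treatment of a degenerate rectangle is required.\<close>
  have "norm (u /\<^sub>R s) \<le> 1" using assms(3) s by (cases "s = 0") (auto simp: field_simps)
  then have "u /\<^sub>R s \<in> closure (convex hull Delta norm \<delta> x)"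
    using assms(1,2) unfolding Daugavet_point_def norm_topology_norm euclidean_closure_of
    by blast
  then obtain p where p: "p \<in> convex hull Delta norm \<delta> x" "dist p (u /\<^sub>R s) < \<delta>"
    using assms(2) closure_approachable by blast
  have "u - s *\<^sub>R p = s *\<^sub>R (u /\<^sub>R s - p)"
    using assms(3) by (cases "s = 0") (auto simp: algebra_simps)
  then have "norm (u - s *\<^sub>R p) \<le> s * \<delta>"
    using p(2) s by (simp add: dist_norm norm_minus_commute mult_left_mono)
  with p(1) show ?thesis using that by blast
qed

section \<open>Transfer to the direct sum\<close>

theorem theorem2p2:
  fixes x :: "'a::banach" and y :: "'b::banach"
    and N :: "real \<times> real \<Rightarrow> real" and a b c d :: real
  assumes "norm x = 1" and "norm y = 1"
    and "absolute_norm N" and "normalised N"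
    and "c = (GREATEST e. N (e, 1) = 1)" and "d = (GREATEST f. N (1, f) = 1)"
    and "octahedral_on {(c, 1), (1, d)} N"
    and "a \<ge> 0" and "b \<ge> 0" and "N (a, b) = 1"
    and "N ((a, b) + (c, 1)) = 2" and "N ((a, b) + (1, d)) = 2"
    and "Daugavet_point norm x" and "Daugavet_point norm y"
  shows "Daugavet_point (sum_norm N) (a *\<^sub>R x, b *\<^sub>R y)"
proof -
  interpret absolute_normalised_norm N
    using assms by unfold_locales
  let ?z = "(a *\<^sub>R x, b *\<^sub>R y)"
  have ab1: "a \<le> 1" "b \<le> 1"
    using fst_le[of a b] snd_le[of a b] assms by simp_all
  have "w \<in> norm_topology (sum_norm N) closure_of (convex hull Delta (sum_norm N) \<epsilon> ?z)"
    if "0 < \<epsilon>" and w: "sum_norm N w \<le> 1" for \<epsilon> and w :: "'a \<times> 'b"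
    unfolding closure_of_norm_topology_iff[OF is_norm_sum_norm[OF absolute]]
  proof (intro allI impI)
    fix r :: real
    assume "0 < r"
    \<comment> \<open>An error \<delta> in each summand becomes at most \<open>2 * \<delta>\<close>
      under \<open>N\<close>; this has to fit both \<epsilon> and \<open>r\<close>.\<close>
    define \<delta> where "\<delta> = min \<epsilon> r / 3"
    have \<delta>: "0 < \<delta>" "2 * \<delta> \<le> \<epsilon>" "2 * \<delta> < r"
      using \<open>0 < \<epsilon>\<close> \<open>0 < r\<close> by (auto simp: \<delta>_def min_def)
    obtain u v where uv: "w = (u, v)" by (cases w)
    obtain s t where st: "norm u \<le> s" "norm v \<le> t" "N (s, t) = 1" "N (a + s, b + t) = 2"
      using dominated_by_additive[of a b c d "norm u" "norm v"] assms w
      by (auto simp: sum_norm_def uv)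
    have st0: "0 \<le> s" "0 \<le> t"
      using st norm_ge_zero[of u] norm_ge_zero[of v] by linarith+
    have st1: "s \<le> 1" "t \<le> 1"
      using fst_le[OF st0] snd_le[OF st0] st by simp_all
    \<comment> \<open>Linear, so that it commutes with convex hulls, and the hull of a product is
      the product of the hulls.\<close>
    define T :: "'a \<times> 'b \<Rightarrow> 'a \<times> 'b" where "T z = (s *\<^sub>R fst z, t *\<^sub>R snd z)" for z
    have "linear T"
      by (rule linearI) (auto simp: T_def algebra_simps)
    have "T (p, q) \<in> Delta (sum_norm N) \<epsilon> ?z"
      if p: "p \<in> Delta norm \<delta> x" and q: "q \<in> Delta norm \<delta> y" for p q
    proof -
      have "N (norm (s *\<^sub>R p), norm (t *\<^sub>R q)) \<le> N (s, t)"
        using p q st0 by (intro mono) (auto simp: Delta_def mult_left_le)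
      moreover have "2 - \<epsilon> \<le> N (norm (a *\<^sub>R x - s *\<^sub>R p), norm (b *\<^sub>R y - t *\<^sub>R q))"
        (is "_ \<le> N (?A, ?B)")
      proof -
        have "a + s - \<delta> \<le> ?A" "b + t - \<delta> \<le> ?B"
          using p q \<delta> ab1 st0 st1 assms by (auto intro!: norm_diff_scaled_ge simp: Delta_def)
        \<comment> \<open>Raising both coordinates by \<delta> reaches a point above
          \<open>(a + s, b + t)\<close>, so monotonicity applies; undoing this costs
          \<open>N (\<delta>, \<delta>)\<close>.\<close>
        then have "2 \<le> N (?A + \<delta>, ?B + \<delta>)"
          using mono[of "a + s" "?A + \<delta>" "b + t" "?B + \<delta>"] st st0 assms by simp
        also have "\<dots> \<le> N (?A, ?B) + 2 * \<delta>"
          using triangle[of "(?A, ?B)" "(\<delta>, \<delta>)"] le_sum[of \<delta> \<delta>] \<delta> by simp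
        finally show ?thesis using \<delta> by simp
      qed
      ultimately show ?thesis
        using st by (simp add: Delta_def sum_norm_def T_def)
    qed
    then have "T ` (Delta norm \<delta> x \<times> Delta norm \<delta> y) \<subseteq> Delta (sum_norm N) \<epsilon> ?z"
      by blast
    then have hull: "T ` ((convex hull Delta norm \<delta> x) \<times> (convex hull Delta norm \<delta> y))
        \<subseteq> convex hull Delta (sum_norm N) \<epsilon> ?z"
      using hull_mono convex_hull_linear_image[OF \<open>linear T\<close>]
      by (metis convex_hull_Times)
    obtain p where p: "p \<in> convex hull Delta norm \<delta> x" "norm (u - s *\<^sub>R p) \<le> s * \<delta>"
      using Daugavet_point_approx assms \<delta> st by blast
    obtain q where q: "q \<in> convex hull Delta norm \<delta> y" "norm (v - t *\<^sub>R q) \<le> t * \<delta>"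
      using Daugavet_point_approx assms \<delta> st by blast
    have "sum_norm N (w - T (p, q)) \<le> norm (u - s *\<^sub>R p) + norm (v - t *\<^sub>R q)"
      using le_sum[of "norm (u - s *\<^sub>R p)" "norm (v - t *\<^sub>R q)"]
      by (simp add: sum_norm_def uv T_def)
    also have "\<dots> \<le> 1 * \<delta> + 1 * \<delta>"
      using p q st1 \<delta> mult_right_mono[of s 1 \<delta>] mult_right_mono[of t 1 \<delta>] by linarith
    also have "\<dots> < r" using \<delta> by simp
    finally show "\<exists>z \<in> convex hull Delta (sum_norm N) \<epsilon> ?z. sum_norm N (w - z) < r"
      using hull p q by blast
  qed
  moreover have "sum_norm N ?z = 1"
    using assms by (simp add: sum_norm_def)
  ultimately show ?thesis
    unfolding Daugavet_point_def by blast
qed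

end
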